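(* For any $\kappa>0$, there is an $m$-transitive dynamical system $(X,T)$ (for some function $m$) such that (1) $\lim_{n\to+\infty}\frac{m(\varepsilon,x,y,n)}{n}=\kappa$ for any $\varepsilon>0$ and any $x,y\in X$, and for any $0<\tilde{\kappa}<\kappa$ and any function $\tilde{m}(\varepsilon,x,y,n)$ with $\lim_{n\to+\infty}\frac{\tilde{m}(\varepsilon,x,y,n)}{n}=\tilde{\kappa}$ for any $\varepsilon>0$ and any $x,y\in X$, $(X,T)$ is not $\tilde{m}$-transitive; (2) the set of periodic points of $(X,T)$ is dense in $X$ and thus $C_T(X)=X$; (3) $(X,T)$ has positive topological entropy; (4) $(X,T)$ does not satisfy the approximate product property; (5) $(X,T)$ is not minimal and is not uniquely ergodic.
   Context: A dynamical system $(X,T)$ is a compact metric space $(X,d)$ with a continuous map $T:X\to X$. $\mathbb{N}=\{0,1,2,\dots\}$, $\mathbb{N}^+=\{1,2,\dots\}$. $(X,T)$ is transitive if for all nonempty open $U,V\subset X$ there is $n\in\mathbb{N}$ with $U\cap T^{-n}V\ne\emptyset$. For a function $m(\varepsilon,x,y,n)\in\mathbb{N}$ of $\varepsilon>0$, $x,y\in X$, $n\in\mathbb{N}^+$, $(X,T)$ is $m$-transitive if it is transitive and for any $\varepsilon>0$ and $x_1,x_2\in X$ there is $N(\varepsilon,x_1,x_2)\in\mathbb{N}^+$ such that for every integer $n\ge N$ there exist $z\in X$ and $p\in\mathbb{N}$ with $0\le p\le m(\varepsilon,x_1,x_2,n)$, $d(z,x_1)<\varepsilon$, and $d(T^{p+j}z,T^jx_2)<\varepsilon$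 for all $0\le j\le n-1$. $(X,T)$ has the approximate product property if for any $\varepsilon>0$, $\delta_1>0$, $\delta_2>0$ there is $N(\varepsilon,\delta_1,\delta_2)\in\mathbb{N}^+$ such that for any $n\ge N$ and any sequence $\{x_i\}_{i\ge1}$ in $X$ there exist a sequence of integers $\{h_i\}_{i\ge1}$ and $x\in X$ with $h_1=0$, $n\le h_{i+1}-h_i\le n(1+\delta_2)$ and $\#\{0\le j\le n-1\mid d(T^{h_i+j}x,T^jx_i)\ge\varepsilon\}\le\delta_1n$ for all $i$. The measure center is $C_T(X)=\overline{\bigcup_{\mu}S_\mu}$, the union over all $T$-invariant Borel probability measures $\mu$, with $S_\mu$ the support of $\mu$. *)

theory Defs
  imports "HOL-Probability.Probability"
begin

(* X is a carrier set: the system is the restriction of d and T to X.  Metric_space also asks d to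
   be nonnegative and symmetric outside X, which restricts nothing (extend d by 0). *)
locale dynamical_system = Metric_space X d
  for X :: "'a set" and d :: "'a \<Rightarrow> 'a \<Rightarrow> real" +
  fixes T :: "'a \<Rightarrow> 'a"
  assumes nonempty: "X \<noteq> {}"
    and compact: "compact_space mtopology"
    and continuous: "continuous_map mtopology mtopology T"
begin

definition transitive :: bool where
  "transitive \<longleftrightarrow> (\<forall>U V. openin mtopology U \<and> U \<noteq> {} \<and> openin mtopology V \<and> V \<noteq> {} \<longrightarrow>
     (\<exists>n::nat. U \<inter> (T ^^ n) -` V \<noteq> {}))"

definition m_transitive :: "(real \<Rightarrow> 'a \<Rightarrow> 'a \<Rightarrow> nat \<Rightarrow> nat) \<Rightarrow> bool" where
  "m_transitive m \<longleftrightarrow> transitive \<and>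
     (\<forall>\<epsilon>>0. \<forall>x1\<in>X. \<forall>x2\<in>X. \<exists>N\<ge>1. \<forall>n\<ge>N.
        \<exists>z\<in>X. \<exists>p\<le>m \<epsilon> x1 x2 n. d z x1 < \<epsilon> \<and>
          (\<forall>j<n. d ((T ^^ (p + j)) z) ((T ^^ j) x2) < \<epsilon>))"

definition periodic_points :: "'a set" where
  "periodic_points = {x \<in> X. \<exists>p\<ge>1. (T ^^ p) x = x}"

definition borel_sigma :: "'a measure" where
  "borel_sigma = sigma X {U. openin mtopology U}"

definition invariant_measures :: "'a measure set" where
  "invariant_measures = {\<mu>. prob_space \<mu> \<and> sets \<mu> = sets borel_sigma \<and>
     (\<forall>A\<in>sets \<mu>. emeasure \<mu> (T -` A \<inter> X) = emeasure \<mu> A)}"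

definition support :: "'a measure \<Rightarrow> 'a set" where
  "support \<mu> = {x \<in> X. \<forall>U. openin mtopology U \<and> x \<in> U \<longrightarrow> emeasure \<mu> U > 0}"

definition measure_center :: "'a set" where
  "measure_center = mtopology closure_of (\<Union>\<mu>\<in>invariant_measures. support \<mu>)"

definition uniquely_ergodic :: bool where
  "uniquely_ergodic \<longleftrightarrow> (\<exists>!\<mu>. \<mu> \<in> invariant_measures)"

definition minimal :: bool where
  "minimal \<longleftrightarrow> (\<forall>x\<in>X. mtopology closure_of {(T ^^ n) x | n. True} = X)"

(* E is (n, eps)-separated: distinct points of E have distance > eps in the Bowen metric
   max {d (T^j x) (T^j y) | 0 <= j < n}. *)
definition separated :: "nat \<Rightarrow> real \<Rightarrow> 'a set \<Rightarrow> bool" where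
  "separated n \<epsilon> E \<longleftrightarrow>
     (\<forall>x\<in>E. \<forall>y\<in>E. x \<noteq> y \<longrightarrow> (\<exists>j<n. d ((T ^^ j) x) ((T ^^ j) y) > \<epsilon>))"

(* limsup (1/n) ln s(n, eps), with s(n, eps) the largest cardinality of an (n, eps)-separated
   set.  The supremum is taken in ereal, outside the logarithm, so that no finiteness
   of s(n, eps) is presupposed; the empty E contributes ln 0 = 0 and is harmless because
   singletons contribute 0 as well. *)
definition separated_growth :: "real \<Rightarrow> ereal" where
  "separated_growth \<epsilon> = limsup (\<lambda>n.
     SUP E\<in>{E. E \<subseteq> X \<and> finite E \<and> separated n \<epsilon> E}. ereal (ln (real (card E)) / real n))"

definition topological_entropy :: ereal where
  "topological_entropy = Lim (at_right 0) separated_growth"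

definition approximate_product_property :: bool where
  "approximate_product_property \<longleftrightarrow>
     (\<forall>\<epsilon>>0. \<forall>\<delta>1>0. \<forall>\<delta>2>0. \<exists>N\<ge>1. \<forall>n\<ge>N. \<forall>xs :: nat \<Rightarrow> 'a. (\<forall>i\<ge>1. xs i \<in> X) \<longrightarrow>
        (\<exists>h :: nat \<Rightarrow> nat. \<exists>x\<in>X. h 1 = 0 \<and>
          (\<forall>i\<ge>1. real n \<le> real (h (i + 1)) - real (h i) \<and>
                  real (h (i + 1)) - real (h i) \<le> real n * (1 + \<delta>2) \<and>
                  real (card {j. j < n \<and> d ((T ^^ (h i + j)) x) ((T ^^ j) (xs i)) \<ge> \<epsilon>})
                    \<le> \<delta>1 * real n)))"

lemma separated_growth_antimono:
  assumes "\<epsilon> \<le> \<epsilon>'"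
  shows "separated_growth \<epsilon>' \<le> separated_growth \<epsilon>"
proof -
  have "separated n \<epsilon> E" if "separated n \<epsilon>' E" for n E
    using that assms unfolding separated_def by (meson le_less_trans)
  then show ?thesis
    unfolding separated_growth_def
    by (intro Limsup_mono always_eventually allI SUP_subset_mono) auto
qed

lemma separated_growth_tendsto_SUP:
  "(separated_growth \<longlongrightarrow> (SUP \<epsilon>\<in>{0<..}. separated_growth \<epsilon>)) (at_right 0)"
proof (rule order_tendstoI)
  fix a assume "a < (SUP \<epsilon>\<in>{0<..}. separated_growth \<epsilon>)"
  then obtain e where e: "e > 0" "a < separated_growth e"
    by (auto simp: less_SUP_iff)
  have "\<forall>\<^sub>F x in at_right 0. x < e"
    using e(1) by (simp add: eventually_at_right_less eventually_at_right_field) blast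
  then show "\<forall>\<^sub>F x in at_right 0. a < separated_growth x"
    by eventually_elim (meson e(2) less_imp_le less_le_trans separated_growth_antimono)
next
  fix a assume a: "(SUP \<epsilon>\<in>{0<..}. separated_growth \<epsilon>) < a"
  have "\<forall>\<^sub>F x in at_right (0::real). x > 0"
    by (rule eventually_at_right_less)
  then show "\<forall>\<^sub>F x in at_right 0. separated_growth x < a"
    by eventually_elim (meson SUP_upper a greaterThan_iff le_less_trans)
qed

lemma topological_entropy_eq_SUP:
  "topological_entropy = (SUP \<epsilon>\<in>{0<..}. separated_growth \<epsilon>)"
  unfolding topological_entropy_def
  by (rule tendsto_Lim[OF trivial_limit_at_right_real separated_growth_tendsto_SUP])

end

end

theory Submission
  imports Defs
begin

text \<open>
  The system is a one-sided subshift on the symbols 0, 1, 2. A symbol 2 acts as a marker that caps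
  the frequency of the symbol 1 after it: in every window that starts at a marker, the
  share of ones is at most \<open>1 / (1 + \<kappa>)\<close>. Zeros are free, and without a marker there is no
  restriction at all.

  To pass from a marker to the point \<open>1\<^sup>\<infinity>\<close> and to follow it for time \<open>n\<close>, an orbit needs a
  window of length at least \<open>(1 + \<kappa>) n\<close>, so the transition takes time at least \<open>\<kappa> n\<close>
  (\<open>m_transitive_gap_lower_bound\<close>). Conversely, a block of \<open>\<kappa> n\<close> zeros, plus a number of zeros
  that does not depend on \<open>n\<close>, pays for everything: any word of the subshift may be followed by
  such a block and then by any word of length \<open>n\<close> (\<open>m_transitive_linear_gap\<close>). Hence \<open>\<kappa>\<close> is the
  exact growth rate of the gap.

  Zeros also make it possible to repeat a word periodically, so periodic points are dense
  (\<open>dense_periodic_points\<close>), and the orbit measures of periodic points then fill the measure center.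
  The full shift on 0 and 1 lies inside the subshift and gives entropy at least \<open>ln 2\<close>.

  The approximate product property fails because the cap is on a frequency, which is stable under
  a small proportion of errors. An orbit that mostly follows \<open>2\<^sup>\<infinity>\<close> during its first block meets a
  marker there; if it mostly followed \<open>1\<^sup>\<infinity>\<close> during all later blocks, with
  gaps that are short compared with the blocks, the frequency of ones after that marker would come
  close to 1 (\<open>not_approximate_product_property\<close>). Finally, \<open>0\<^sup>\<infinity>\<close> and \<open>1\<^sup>\<infinity>\<close> are two fixed
  points, which excludes minimality and unique ergodicity.
\<close>

section \<open>Invariant measures carried by periodic points\<close>

context dynamical_system
begin

lemma funpow_in: "x \<in> X \<Longrightarrow> (T ^^ n) x \<in> X"
  using continuous by (induction n) (auto simp: continuous_map_def)

lemma space_borel_sigma [simp]: "space borel_sigma = X"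
  unfolding borel_sigma_def using openin_subset[of mtopology] by (intro space_measure_of) auto

lemma sets_borel_sigma: "sets borel_sigma = sigma_sets X {U. openin mtopology U}"
  unfolding borel_sigma_def using openin_subset[of mtopology] by (intro sets_measure_of) auto

lemma open_in_borel_sigma: "openin mtopology U \<Longrightarrow> U \<in> sets borel_sigma"
  by (simp add: sets_borel_sigma sigma_sets.Basic)

lemma T_measurable: "T \<in> borel_sigma \<rightarrow>\<^sub>M borel_sigma"
proof (rule measurable_sigma_sets[OF sets_borel_sigma])
  show "{U. openin mtopology U} \<subseteq> Pow X"
    using openin_subset[of mtopology] by auto
  show "T \<in> space borel_sigma \<rightarrow> X"
    using continuous by (auto simp: continuous_map_def)
next
  fix U assume "U \<in> {U. openin mtopology U}"
  then have "openin mtopology {x \<in> X. T x \<in> U}"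
    using continuous by (simp add: continuous_map_def)
  then show "T -` U \<inter> space borel_sigma \<in> sets borel_sigma"
    by (intro open_in_borel_sigma) (simp add: vimage_def Collect_conj_eq Int_commute)
qed

text \<open>The orbit measure of a periodic point is the image of the uniform distribution on one
  period; it is invariant because \<open>j \<mapsto> j + 1\<close> modulo the period permutes the residues.\<close>

lemma periodic_orbit_measure:
  assumes "x \<in> X" "p \<ge> 1" "(T ^^ p) x = x"
  obtains \<mu> where "\<mu> \<in> invariant_measures"
    "\<And>A. A \<in> sets borel_sigma \<Longrightarrow> emeasure \<mu> A = measure_pmf (pmf_of_set {..<p}) {j. (T ^^ j) x \<in> A}"
proof -
  define f where "f j = (T ^^ j) x" for j
  let ?q = "pmf_of_set {..<p}"
  define \<mu> where "\<mu> = distr (measure_pmf ?q) borel_sigma f"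
  have f: "f \<in> measure_pmf ?q \<rightarrow>\<^sub>M borel_sigma"
    by (simp add: f_def assms(1) funpow_in)
  have em: "emeasure \<mu> A = measure_pmf ?q {j. f j \<in> A}" if "A \<in> sets borel_sigma" for A
    unfolding \<mu>_def using that by (simp add: emeasure_distr[OF f] vimage_def)
  have bij: "bij_betw (\<lambda>j. Suc j mod p) {..<p} {..<p}"
    unfolding bij_betw_def
  proof
    have "Suc i mod p \<noteq> Suc j mod p" if "i < j" "j < p" for i j
      using that by (cases "Suc j = p") auto
    then show "inj_on (\<lambda>j. Suc j mod p) {..<p}"
      by (intro inj_onI) (metis lessThan_iff linorder_neqE_nat)
    then show "(\<lambda>j. Suc j mod p) ` {..<p} = {..<p}"
      using assms by (intro endo_inj_surj) auto
  qed
  have rot: "map_pmf (\<lambda>j. Suc j mod p) ?q = ?q"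
    using assms by (intro map_pmf_of_set_bij_betw[OF bij]) (auto simp: lessThan_empty_iff)
  have f_mod: "f (j mod p) = f j" for j
    unfolding f_def by (rule funpow_mod_eq[OF assms(3)])
  have "emeasure \<mu> (T -` A \<inter> X) = emeasure \<mu> A" if A: "A \<in> sets borel_sigma" for A
  proof -
    have "T -` A \<inter> X \<in> sets borel_sigma"
      using measurable_sets[OF T_measurable A] by simp
    then have "emeasure \<mu> (T -` A \<inter> X) = measure_pmf ?q {j. f j \<in> T -` A \<inter> X}"
      by (rule em)
    also have "{j. f j \<in> T -` A \<inter> X} = (\<lambda>j. Suc j mod p) -` {j. f j \<in> A}"
      by (auto simp: f_mod) (auto simp: f_def assms(1) funpow_in)
    also have "measure_pmf ?q \<dots> = measure_pmf (map_pmf (\<lambda>j. Suc j mod p) ?q) {j. f j \<in> A}"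
      by simp
    also have "\<dots> = emeasure \<mu> A"
      using A by (simp add: rot em)
    finally show ?thesis .
  qed
  moreover have "prob_space \<mu>"
    unfolding \<mu>_def by (rule prob_space.prob_space_distr[OF prob_space_measure_pmf f])
  ultimately have "\<mu> \<in> invariant_measures"
    by (simp add: invariant_measures_def \<mu>_def)
  with em that show thesis
    by (simp add: f_def)
qed

lemma periodic_points_subset_support:
  "periodic_points \<subseteq> (\<Union>\<mu>\<in>invariant_measures. support \<mu>)"
proof
  fix x assume "x \<in> periodic_points"
  then obtain p where x: "x \<in> X" "p \<ge> 1" "(T ^^ p) x = x"
    by (auto simp: periodic_points_def)
  obtain \<mu> where \<mu>: "\<mu> \<in> invariant_measures"
    "\<And>A. A \<in> sets borel_sigma \<Longrightarrow> emeasure \<mu> A = measure_pmf (pmf_of_set {..<p}) {j. (T ^^ j) x \<in> A}"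
    using periodic_orbit_measure[OF x] by metis
  have "emeasure \<mu> U > 0" if U: "openin mtopology U" "x \<in> U" for U
  proof -
    have "0 \<in> {j. (T ^^ j) x \<in> U} \<inter> set_pmf (pmf_of_set {..<p})"
      using U x by (auto simp: lessThan_empty_iff)
    then have "measure_pmf (pmf_of_set {..<p}) {j. (T ^^ j) x \<in> U} \<noteq> 0"
      by (auto simp: measure_pmf.emeasure_eq_measure measure_pmf_zero_iff)
    then show ?thesis
      by (simp add: \<mu>(2) open_in_borel_sigma U zero_less_iff_neq_zero)
  qed
  with \<mu> x show "x \<in> (\<Union>\<mu>\<in>invariant_measures. support \<mu>)"
    by (auto simp: support_def)
qed

lemma dense_periodic_points_imp_measure_center:
  assumes "mtopology closure_of periodic_points = X"
  shows "measure_center = X"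
proof
  show "measure_center \<subseteq> X"
    unfolding measure_center_def by (metis closure_of_subset_topspace topspace_mtopology)
  show "X \<subseteq> measure_center"
    unfolding measure_center_def using assms closure_of_mono[OF periodic_points_subset_support]
    by metis
qed

lemma singleton_in_borel_sigma:
  assumes "x \<in> X" shows "{x} \<in> sets borel_sigma"
proof -
  have "closedin mtopology {x}"
    using assms by (simp add: closedin_Hausdorff_singleton Hausdorff_space_mtopology)
  then have "X - {x} \<in> sets borel_sigma"
    by (intro open_in_borel_sigma) (simp add: closedin_def)
  then have "space borel_sigma - (X - {x}) \<in> sets borel_sigma"
    by (rule sets.compl_sets)
  then show ?thesis
    using assms by (simp add: double_diff)
qed

lemma two_fixed_points:
  assumes x: "x \<in> X" "T x = x" and y: "y \<in> X" "T y = y" and "x \<noteq> y"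
  shows "\<not> minimal" "\<not> uniquely_ergodic"
proof -
  have "(T ^^ n) x = x" for n
    by (induction n) (simp_all add: x)
  then have "{(T ^^ n) x | n. True} = {x}" by simp
  moreover have "mtopology closure_of {x} = {x}"
    using x by (intro closure_of_closedin)
      (simp add: closedin_Hausdorff_singleton Hausdorff_space_mtopology)
  ultimately show "\<not> minimal"
    unfolding minimal_def using x(1) y(1) \<open>x \<noteq> y\<close> by (auto intro!: bexI[of _ x])
  have ex: "\<exists>\<mu>\<in>invariant_measures. \<forall>A\<in>sets borel_sigma. emeasure \<mu> A = indicator A z"
    if "z \<in> X" "T z = z" for z
  proof -
    have "(T ^^ Suc 0) z = z" using that by simp
    from periodic_orbit_measure[OF that(1) _ this] obtain \<mu> where "\<mu> \<in> invariant_measures"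
      "\<And>A. A \<in> sets borel_sigma \<Longrightarrow> emeasure \<mu> A = measure_pmf (return_pmf 0) {j. (T ^^ j) z \<in> A}"
      by (auto simp: lessThan_Suc pmf_of_set_singleton)
    then show ?thesis
      by (intro bexI[of _ \<mu>]) (simp_all add: indicator_def)
  qed
  obtain \<mu> \<nu> where "\<mu> \<in> invariant_measures" "emeasure \<mu> {x} = 1"
      and "\<nu> \<in> invariant_measures" "emeasure \<nu> {x} = 0"
    using ex[OF x] ex[OF y] singleton_in_borel_sigma[OF x(1)] \<open>x \<noteq> y\<close>
    by (auto simp: indicator_def)
  then show "\<not> uniquely_ergodic"
    unfolding uniquely_ergodic_def by (metis zero_neq_one)
qed

text \<open>Topological transitivity is the shadowing condition for orbit segments of length one, so only
  that condition has to be checked.\<close>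

lemma shadowing_imp_m_transitive:
  assumes "\<And>\<epsilon> x1 x2. \<epsilon> > 0 \<Longrightarrow> x1 \<in> X \<Longrightarrow> x2 \<in> X \<Longrightarrow> \<exists>N\<ge>1. \<forall>n\<ge>N.
     \<exists>z\<in>X. \<exists>p\<le>m \<epsilon> x1 x2 n. d z x1 < \<epsilon> \<and> (\<forall>j<n. d ((T ^^ (p + j)) z) ((T ^^ j) x2) < \<epsilon>)"
  shows "m_transitive m"
proof -
  have "\<exists>n. U \<inter> (T ^^ n) -` V \<noteq> {}"
    if U: "openin mtopology U" "U \<noteq> {}" and V: "openin mtopology V" "V \<noteq> {}" for U V
  proof -
    obtain x1 x2 where x: "x1 \<in> U" "x2 \<in> V" using U V by auto
    then have X: "x1 \<in> X" "x2 \<in> X"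
      using U V openin_subset by fastforce+
    obtain r s where "r > 0" "s > 0" and rs: "mball x1 r \<subseteq> U" "mball x2 s \<subseteq> V"
      using U V x by (meson openin_mtopology)
    then have "min r s > 0" by simp
    from assms[OF this X] obtain N p z where "N \<ge> 1" and z: "z \<in> X" "d z x1 < min r s"
        and "\<forall>j<N. d ((T ^^ (p + j)) z) ((T ^^ j) x2) < min r s"
      by (meson order_refl)
    then have "d ((T ^^ (p + 0)) z) ((T ^^ 0) x2) < min r s"
      using less_le_trans[OF zero_less_one] by blast
    then have "d ((T ^^ p) z) x2 < s" by simp
    then have "z \<in> U" "(T ^^ p) z \<in> V"
      using z X rs funpow_in[OF z(1)] by (auto simp: subset_iff in_mball commute)
    then show ?thesis by auto
  qed
  with assms show ?thesis
    unfolding m_transitive_def transitive_def by simp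
qed

end

section \<open>Sequence space\<close>

text \<open>The ultrametric in which distance at most \<open>(1/2)^k\<close> means agreement of the first \<open>k\<close> entries turns all
  estimates for orbits into statements about words, and still induces the product topology.\<close>

definition prefix_dist :: "(nat \<Rightarrow> 'a) \<Rightarrow> (nat \<Rightarrow> 'a) \<Rightarrow> real" where
  "prefix_dist x y = (if x = y then 0 else (1/2) ^ (LEAST i. x i \<noteq> y i))"

lemma prefix_dist_le_iff: "prefix_dist x y \<le> (1/2) ^ k \<longleftrightarrow> (\<forall>i<k. x i = y i)"
proof (cases "x = y")
  case False
  define l where "l = (LEAST i. x i \<noteq> y i)"
  have l: "x l \<noteq> y l"
    unfolding l_def using False by (intro LeastI_ex[of "\<lambda>i. x i \<noteq> y i"]) (auto simp: fun_eq_iff)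
  have below: "x i = y i" if "i < l" for i
    using that not_less_Least[of i "\<lambda>i. x i \<noteq> y i"] by (auto simp: l_def)
  have "(1/2 :: real) ^ l \<le> (1/2) ^ k \<longleftrightarrow> k \<le> l"
    by (rule power_decreasing_iff) auto
  also have "\<dots> \<longleftrightarrow> (\<forall>i<k. x i = y i)"
    using l below by (meson less_le_trans not_less)
  finally show ?thesis
    using False by (simp add: prefix_dist_def l_def)
qed (simp add: prefix_dist_def)

lemma prefix_dist_less_1_iff: "prefix_dist x y < 1 \<longleftrightarrow> x 0 = y 0"
proof
  assume "prefix_dist x y < 1"
  then show "x 0 = y 0"
    by (cases "x 0 = y 0") (auto simp: prefix_dist_def Least_eq_0 split: if_splits)
next
  assume "x 0 = y 0"
  then have "prefix_dist x y \<le> (1/2) ^ 1"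
    unfolding prefix_dist_le_iff by simp
  then show "prefix_dist x y < 1" by simp
qed

lemma agreement_imp_prefix_dist_less:
  assumes "\<epsilon> > 0"
  obtains k where "\<And>x y. (\<forall>i<k. x i = y i) \<Longrightarrow> prefix_dist x y < \<epsilon>"
proof -
  obtain k where "(1/2 :: real) ^ k < \<epsilon>"
    using assms real_arch_pow_inv[of \<epsilon> "1/2"] by auto
  then have "prefix_dist x y < \<epsilon>" if "\<forall>i<k. x i = y i" for x y :: "nat \<Rightarrow> 'a"
    using that by (meson le_less_trans prefix_dist_le_iff)
  with that show thesis by blast
qed

lemma Metric_space_prefix_dist: "Metric_space S prefix_dist"
proof
  show "0 \<le> prefix_dist x y" for x y :: "nat \<Rightarrow> 'a"
    by (simp add: prefix_dist_def)
  show "prefix_dist x y = prefix_dist y x" for x y :: "nat \<Rightarrow> 'a"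
    by (simp add: prefix_dist_def eq_commute)
  show "(prefix_dist x y = 0) = (x = y)" for x y :: "nat \<Rightarrow> 'a"
    by (simp add: prefix_dist_def)
  show "prefix_dist x z \<le> prefix_dist x y + prefix_dist y z" for x y z :: "nat \<Rightarrow> 'a"
  proof (cases "x = y \<or> y = z")
    case False
    then obtain k l where kl: "prefix_dist x y = (1/2) ^ k" "prefix_dist y z = (1/2) ^ l"
      by (simp add: prefix_dist_def)
    then have "\<forall>i<k. x i = y i" "\<forall>i<l. y i = z i"
      using prefix_dist_le_iff[of x y k] prefix_dist_le_iff[of y z l] by simp_all
    then have "prefix_dist x z \<le> (1/2) ^ min k l"
      by (simp add: prefix_dist_le_iff)
    also have "\<dots> \<le> (1/2) ^ k + (1/2) ^ l"
      by (simp add: min_def)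
    finally show ?thesis by (simp add: kl)
  qed (auto simp: prefix_dist_def)
qed

lemma open_iff_cylinders:
  fixes U :: "(nat \<Rightarrow> nat) set"
  shows "open U \<longleftrightarrow> (\<forall>x\<in>U. \<exists>k. {y. \<forall>i<k. y i = x i} \<subseteq> U)"
proof
  assume "open U"
  show "\<forall>x\<in>U. \<exists>k. {y. \<forall>i<k. y i = x i} \<subseteq> U"
  proof
    fix x assume "x \<in> U"
    from \<open>open U\<close> have "openin (product_topology (\<lambda>i. euclidean) UNIV) U"
      by (simp add: open_fun_def)
    from product_topology_open_contains_basis[OF this \<open>x \<in> U\<close>]
    obtain B where B: "x \<in> PiE UNIV B" "finite {i. B i \<noteq> UNIV}" "PiE UNIV B \<subseteq> U"
      by auto
    then obtain k where k: "{i. B i \<noteq> UNIV} \<subseteq> {..<k}"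
      using finite_nat_iff_bounded by auto
    have "y \<in> PiE UNIV B" if "\<forall>i<k. y i = x i" for y
    proof (intro PiE_I)
      fix i show "y i \<in> B i"
        using k PiE_mem[OF B(1), of i] that by (cases "B i = UNIV") auto
    qed auto
    with B show "\<exists>k. {y. \<forall>i<k. y i = x i} \<subseteq> U" by blast
  qed
next
  assume cyl: "\<forall>x\<in>U. \<exists>k. {y. \<forall>i<k. y i = x i} \<subseteq> U"
  show "open U"
  proof (rule Topological_Spaces.openI)
    fix x assume "x \<in> U"
    then obtain k where "{y. \<forall>i<k. y i = x i} \<subseteq> U" using cyl by blast
    moreover have "open {y. \<forall>i\<in>{..<k}. y i \<in> {x i}}"
      by (rule product_topology_basis'[where x = "\<lambda>i. i"]) (auto simp: Topological_Spaces.open_discrete)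
    moreover have "{y. \<forall>i\<in>{..<k}. y i \<in> {x i}} = {y. \<forall>i<k. y i = x i}" by auto
    ultimately show "\<exists>T. open T \<and> x \<in> T \<and> T \<subseteq> U"
      by (intro exI[of _ "{y. \<forall>i<k. y i = x i}"]) auto
  qed
qed

text \<open>Compactness and continuity can therefore be taken from the product topology.\<close>

lemma mtopology_prefix_dist:
  "Metric_space.mtopology S prefix_dist = top_of_set (S :: (nat \<Rightarrow> nat) set)"
proof -
  interpret P: Submetric UNIV prefix_dist S
    by (intro Submetric.intro Metric_space_prefix_dist Submetric_axioms.intro) simp
  have "openin P.mtopology U \<longleftrightarrow> open U" for U
  proof -
    have "(\<exists>r>0. P.mcball x r \<subseteq> U) \<longleftrightarrow> (\<exists>k. {y. \<forall>i<k. y i = x i} \<subseteq> U)" for x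
    proof
      assume "\<exists>r>0. P.mcball x r \<subseteq> U"
      then obtain r where r: "r > 0" "P.mcball x r \<subseteq> U" by blast
      obtain k where "\<And>x y :: nat \<Rightarrow> nat. (\<forall>i<k. x i = y i) \<Longrightarrow> prefix_dist x y < r"
        using agreement_imp_prefix_dist_less[OF r(1)] by metis
      then have "{y. \<forall>i<k. y i = x i} \<subseteq> P.mcball x r"
        by (simp add: subset_iff P.in_mcball less_imp_le)
      with r show "\<exists>k. {y. \<forall>i<k. y i = x i} \<subseteq> U" by blast
    next
      assume "\<exists>k. {y. \<forall>i<k. y i = x i} \<subseteq> U"
      then obtain k where "{y. \<forall>i<k. y i = x i} \<subseteq> U" by blast
      moreover have "P.mcball x ((1/2) ^ k) = {y. \<forall>i<k. y i = x i}"
        by (auto simp: P.mcball_def prefix_dist_le_iff)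
      ultimately show "\<exists>r>0. P.mcball x r \<subseteq> U"
        by (intro exI[of _ "(1/2) ^ k"]) simp
    qed
    then show ?thesis
      by (simp add: P.openin_mtopology_mcball open_iff_cylinders Ball_def)
  qed
  then have "P.mtopology = euclidean"
    by (simp add: topology_eq)
  with P.mtopology_submetric show ?thesis by simp
qed

section \<open>The left shift\<close>

definition left_shift :: "(nat \<Rightarrow> 'a) \<Rightarrow> nat \<Rightarrow> 'a" where
  "left_shift x = (\<lambda>i. x (Suc i))"

lemma left_shift_const [simp]: "left_shift (\<lambda>_. c) = (\<lambda>_. c)"
  by (simp add: left_shift_def)

lemma funpow_left_shift: "(left_shift ^^ n) x = (\<lambda>i. x (n + i))"
  by (induction n arbitrary: x) (simp_all add: left_shift_def funpow_swap1)

section \<open>The marker subshift\<close>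

definition ones :: "(nat \<Rightarrow> nat) \<Rightarrow> nat \<Rightarrow> nat \<Rightarrow> nat" where
  "ones x i j = card {l \<in> {i..<j}. x l = 1}"

text \<open>The window \<open>{i..<j}\<close> contains the marker itself, which is never a one; with half-open windows,
  lengths and numbers of ones are additive.\<close>

definition marker_shift :: "real \<Rightarrow> (nat \<Rightarrow> nat) set" where
  "marker_shift \<kappa> = {x. range x \<subseteq> {0, 1, 2} \<and>
     (\<forall>i j. x i = 2 \<longrightarrow> (1 + \<kappa>) * real (ones x i j) \<le> real (j - i))}"

lemma marker_shiftD:
  "x \<in> marker_shift \<kappa> \<Longrightarrow> x i = 2 \<Longrightarrow> (1 + \<kappa>) * real (ones x i j) \<le> real (j - i)"
  by (simp add: marker_shift_def)

lemma marker_shift_range: "x \<in> marker_shift \<kappa> \<Longrightarrow> x i \<in> {0, 1, 2}"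
  unfolding marker_shift_def by blast

lemma ones_cong: "(\<And>l. i \<le> l \<Longrightarrow> l < j \<Longrightarrow> x l = y l) \<Longrightarrow> ones x i j = ones y i j"
  unfolding ones_def by (rule arg_cong[where f = card]) auto

lemma card_le_ones: "A \<subseteq> {i..<j} \<Longrightarrow> (\<And>l. l \<in> A \<Longrightarrow> x l = 1) \<Longrightarrow> card A \<le> ones x i j"
  unfolding ones_def by (intro card_mono) auto

lemma left_shift_in_marker_shift:
  assumes "x \<in> marker_shift \<kappa>" shows "left_shift x \<in> marker_shift \<kappa>"
proof -
  have "ones (left_shift x) i j = ones x (Suc i) (Suc j)" for i j
  proof -
    have "{l \<in> {Suc i..<Suc j}. x l = 1} = Suc ` {l \<in> {i..<j}. left_shift x l = 1}"
    proof (intro set_eqI iffI)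
      fix l assume "l \<in> {l \<in> {Suc i..<Suc j}. x l = 1}"
      then show "l \<in> Suc ` {l \<in> {i..<j}. left_shift x l = 1}"
        by (cases l) (auto simp: left_shift_def)
    qed (auto simp: left_shift_def)
    then show ?thesis
      by (simp add: ones_def card_image)
  qed
  with assms show ?thesis
    by (auto simp: marker_shift_def left_shift_def[of x] image_subset_iff) (metis diff_Suc_Suc)
qed

lemma const_in_marker_shift:
  assumes "c \<in> {0, 1, 2}"
  shows "(\<lambda>_. c) \<in> marker_shift \<kappa>"
  using assms by (auto simp: marker_shift_def ones_def)

lemma binary_in_marker_shift:
  assumes "range x \<subseteq> {0, 1}"
  shows "x \<in> marker_shift \<kappa>"
proof -
  have "x i \<in> {0, 1}" for i using assms by blast
  then have "x i \<noteq> 2" for i by (metis empty_iff insert_iff zero_neq_numeral one_eq_numeral_iff num.distinct(1))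
  with assms show ?thesis by (auto simp: marker_shift_def)
qed

text \<open>A sequence outside the subshift already shows a forbidden word in a finite prefix, so the
  complement is open.\<close>

lemma compact_marker_shift: "compact (marker_shift \<kappa>)"
proof -
  have "open (- marker_shift \<kappa>)"
    unfolding open_iff_cylinders
  proof
    fix x assume "x \<in> - marker_shift \<kappa>"
    then consider i where "x i \<notin> {0, 1, 2}"
      | i j where "x i = 2" "\<not> (1 + \<kappa>) * real (ones x i j) \<le> real (j - i)"
      by (auto simp: marker_shift_def)
    then show "\<exists>k. {y. \<forall>i<k. y i = x i} \<subseteq> - marker_shift \<kappa>"
    proof cases
      case 1
      have "y \<in> - marker_shift \<kappa>" if "\<forall>l<Suc i. y l = x l" for y
        using that 1 by (metis ComplI lessI marker_shift_range)
      then show ?thesis by blast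
    next
      case 2
      have "y \<in> - marker_shift \<kappa>" if "\<forall>l<Suc (i + j). y l = x l" for y
      proof -
        have "ones y i j = ones x i j" by (rule ones_cong) (simp add: that)
        moreover have "y i = 2" using that 2 by simp
        ultimately show ?thesis using 2 marker_shiftD[of y \<kappa> i j] by auto
      qed
      then show ?thesis by blast
    qed
  qed
  moreover have "compact (PiE UNIV (\<lambda>_. {0, 1, 2}) :: (nat \<Rightarrow> nat) set)"
    using compactin_PiE[of "\<lambda>_. euclidean" "UNIV :: nat set" "\<lambda>_. {0, 1, 2 :: nat}"]
    by (simp add: euclidean_product_topology)
  ultimately have "compact (PiE UNIV (\<lambda>_. {0, 1, 2}) \<inter> marker_shift \<kappa>)"
    by (auto simp: closed_def intro: compact_Int_closed)
  also have "PiE UNIV (\<lambda>_. {0, 1, 2}) \<inter> marker_shift \<kappa> = marker_shift \<kappa>"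
    by (auto simp: marker_shift_def)
  finally show ?thesis .
qed

lemma continuous_on_left_shift: "continuous_on S (left_shift :: (nat \<Rightarrow> nat) \<Rightarrow> nat \<Rightarrow> nat)"
  unfolding left_shift_def
  by (intro continuous_on_coordinatewise_then_product
      continuous_on_subset[OF continuous_on_product_coordinates]) simp

lemma dynamical_system_marker_shift: "dynamical_system (marker_shift \<kappa>) prefix_dist left_shift"
proof (intro dynamical_system.intro dynamical_system_axioms.intro Metric_space_prefix_dist)
  show "marker_shift \<kappa> \<noteq> {}"
    using const_in_marker_shift[of 0] by blast
  show "compact_space (Metric_space.mtopology (marker_shift \<kappa>) prefix_dist)"
    unfolding mtopology_prefix_dist
    by (intro compact_space_subtopology) (simp add: compact_marker_shift)
  show "continuous_map (Metric_space.mtopology (marker_shift \<kappa>) prefix_dist)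
     (Metric_space.mtopology (marker_shift \<kappa>) prefix_dist) left_shift"
    unfolding mtopology_prefix_dist
    by (auto simp: continuous_on_left_shift left_shift_in_marker_shift)
qed

section \<open>Building points of the subshift\<close>

lemma ones_le_card:
  assumes "finite S" "\<And>l. i \<le> l \<Longrightarrow> l < j \<Longrightarrow> x l = 1 \<Longrightarrow> l \<in> S"
  shows "ones x i j \<le> card S"
  unfolding ones_def using assms by (intro card_mono) auto

lemma ones_le_ones:
  assumes "\<And>l. i \<le> l \<Longrightarrow> l < j \<Longrightarrow> z l = 1 \<Longrightarrow> c \<le> l \<and> i' \<le> l - c \<and> l - c < j' \<and> x (l - c) = 1"
  shows "ones z i j \<le> ones x i' j'"
  unfolding ones_def
proof (rule card_inj_on_le)
  show "inj_on (\<lambda>l. l - c) {l \<in> {i..<j}. z l = 1}"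
    using assms by (intro inj_onI) (metis (mono_tags, lifting) atLeastLessThan_iff eq_diff_iff mem_Collect_eq)
  show "(\<lambda>l. l - c) ` {l \<in> {i..<j}. z l = 1} \<subseteq> {l \<in> {i'..<j'}. x l = 1}"
    using assms by auto
qed simp

text \<open>In the notation of words, this is \<open>x[0,a) 0\<^sup>q y[0,b) 0\<^sup>\<infinity>\<close>.\<close>

definition glue :: "(nat \<Rightarrow> nat) \<Rightarrow> nat \<Rightarrow> nat \<Rightarrow> (nat \<Rightarrow> nat) \<Rightarrow> nat \<Rightarrow> nat \<Rightarrow> nat" where
  "glue x a q y b = (\<lambda>i. if i < a then x i
     else if a + q \<le> i \<and> i < a + q + b then y (i - (a + q)) else 0)"

text \<open>Only a marker in the first word whose window reaches into the second word is affected by the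
  gluing. If the window covers \<open>s \<le> b\<close> symbols of the second word, it contains at most \<open>a + s\<close> ones
  and has length at least \<open>q + s\<close>. The requirement \<open>(1 + \<kappa>) (a + s) \<le> q + s\<close> is most
  demanding at \<open>s = b\<close>, where it is the hypothesis on \<open>q\<close>.\<close>

lemma glue_in_marker_shift:
  assumes x: "x \<in> marker_shift \<kappa>" and y: "y \<in> marker_shift \<kappa>" and "\<kappa> \<ge> 0"
    and q: "(1 + \<kappa>) * real a + \<kappa> * real b \<le> real q"
  shows "glue x a q y b \<in> marker_shift \<kappa>"
proof -
  let ?z = "glue x a q y b"
  have "(1 + \<kappa>) * real (ones ?z i j) \<le> real (j - i)" if marker: "?z i = 2" for i j
  proof -
    consider "i < a" "j \<le> a + q" | "i < a" "a + q < j" | "a + q \<le> i"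
      using marker by (fastforce simp: glue_def split: if_splits)
    then show ?thesis
    proof cases
      case 1
      have "ones ?z i j \<le> ones x i (min j a)"
        using 1 by (intro ones_le_ones[where c = 0]) (auto simp: glue_def split: if_splits)
      then have "(1 + \<kappa>) * real (ones ?z i j) \<le> (1 + \<kappa>) * real (ones x i (min j a))"
        using \<open>\<kappa> \<ge> 0\<close> by (intro mult_left_mono) auto
      also have "\<dots> \<le> real (min j a - i)"
        using marker 1 by (intro marker_shiftD[OF x]) (simp add: glue_def)
      also have "\<dots> \<le> real (j - i)" by simp
      finally show ?thesis .
    next
      case 2
      define s where "s = min (j - (a + q)) b"
      have "ones ?z i j \<le> card ({..<a} \<union> {a + q..<a + q + s})"
        using 2 by (intro ones_le_card) (auto simp: glue_def s_def split: if_splits)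
      also have "\<dots> \<le> a + s"
        by (rule order_trans[OF card_Un_le]) simp
      finally have "(1 + \<kappa>) * real (ones ?z i j) \<le> (1 + \<kappa>) * real (a + s)"
        using \<open>\<kappa> \<ge> 0\<close> by (intro mult_left_mono) auto
      also have "\<dots> = (1 + \<kappa>) * real a + \<kappa> * real s + real s"
        by (simp add: algebra_simps)
      also have "\<kappa> * real s \<le> \<kappa> * real b"
        using \<open>\<kappa> \<ge> 0\<close> by (intro mult_left_mono) (auto simp: s_def)
      also have "(1 + \<kappa>) * real a + \<kappa> * real b + real s \<le> real (q + s)"
        using q by simp
      also have "\<dots> \<le> real (j - i)"
        using 2 by (simp add: s_def)
      finally show ?thesis by simp
    next
      case 3
      have "ones ?z i j \<le> ones y (i - (a + q)) (j - (a + q))"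
        using 3 by (intro ones_le_ones[where c = "a + q"]) (auto simp: glue_def split: if_splits)
      then have "(1 + \<kappa>) * real (ones ?z i j) \<le> (1 + \<kappa>) * real (ones y (i - (a + q)) (j - (a + q)))"
        using \<open>\<kappa> \<ge> 0\<close> by (intro mult_left_mono) auto
      also have "\<dots> \<le> real (j - (a + q) - (i - (a + q)))"
        using marker 3 by (intro marker_shiftD[OF y]) (auto simp: glue_def split: if_splits)
      also have "\<dots> \<le> real (j - i)" by simp
      finally show ?thesis .
    qed
  qed
  moreover have "?z i \<in> {0, 1, 2}" for i
    using marker_shift_range[OF x, of i] marker_shift_range[OF y, of "i - (a + q)"]
    by (simp add: glue_def)
  ultimately show ?thesis by (simp add: marker_shift_def image_subset_iff)
qed

definition periodize :: "(nat \<Rightarrow> nat) \<Rightarrow> nat \<Rightarrow> nat \<Rightarrow> nat \<Rightarrow> nat" where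
  "periodize x a P = (\<lambda>i. if i mod P < a then x (i mod P) else 0)"

text \<open>A window that starts at a marker and ends inside the same period is a window of \<open>x\<close> up to
  zeros. If it ends \<open>t \<ge> 1\<close> periods later, it meets \<open>t + 1 \<le> 2 t\<close> copies of the word, hence at
  most \<open>2 t a\<close> ones, while its length is at least \<open>t q\<close>.\<close>

lemma periodize_in_marker_shift:
  assumes x: "x \<in> marker_shift \<kappa>" and "\<kappa> \<ge> 0" and q: "2 * (1 + \<kappa>) * real a \<le> real q" and "q > 0"
  shows "periodize x a (a + q) \<in> marker_shift \<kappa>"
proof -
  define P where "P = a + q"
  have "P > 0" using \<open>q > 0\<close> by (simp add: P_def)
  let ?z = "periodize x a P"
  have "(1 + \<kappa>) * real (ones ?z i j) \<le> real (j - i)" if marker: "?z i = 2" for i j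
  proof -
    define c where "c = i div P"
    define r where "r = i mod P"
    have i: "i = P * c + r" "r < a" "x r = 2"
      using marker by (auto simp: periodize_def c_def r_def split: if_splits)
    show ?thesis
    proof (cases "j \<le> P * (c + 1)")
      case True
      have "P * c \<le> l \<and> r \<le> l - P * c \<and> l - P * c < min a (j - P * c) \<and> x (l - P * c) = 1"
        if l: "i \<le> l" "l < j" "?z l = 1" for l
      proof -
        have "P * c \<le> l" "l < P * (c + 1)" using l i True by linarith+
        then have "l div P = c"
          by (intro div_nat_eqI) (auto simp: mult.commute)
        then have "l mod P = l - P * c"
          by (metis minus_mult_div_eq_mod)
        with l i \<open>P * c \<le> l\<close> show ?thesis
          by (auto simp: periodize_def split: if_splits)
      qed
      then have "ones ?z i j \<le> ones x r (min a (j - P * c))"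
        by (intro ones_le_ones[where c = "P * c"]) blast
      then have "(1 + \<kappa>) * real (ones ?z i j) \<le> (1 + \<kappa>) * real (ones x r (min a (j - P * c)))"
        using \<open>\<kappa> \<ge> 0\<close> by (intro mult_left_mono) auto
      also have "\<dots> \<le> real (min a (j - P * c) - r)"
        using i by (intro marker_shiftD[OF x])
      also have "\<dots> \<le> real (j - i)" using i by simp
      finally show ?thesis .
    next
      case False
      define t where "t = (j - 1) div P - c"
      have "P * (c + 1) \<le> j - 1" using False by simp
      then have "c + 1 \<le> (j - 1) div P"
        using \<open>P > 0\<close> by (simp add: less_eq_div_iff_mult_less_eq mult.commute)
      then have t: "t \<ge> 1" "(j - 1) div P = c + t" by (simp_all add: t_def)
      then have "P * (c + t) \<le> j - 1"
        by (metis times_div_less_eq_dividend)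
      then have len: "t * q + i \<le> j"
      proof -
        have "t * q + i \<le> t * q + P * c + a" using i by simp
        also have "\<dots> \<le> t * q + P * c + t * a" using t(1) by simp
        also have "\<dots> = P * (c + t)" by (simp add: P_def algebra_simps)
        finally show ?thesis using \<open>P * (c + t) \<le> j - 1\<close> by linarith
      qed
      have "ones ?z i j \<le> card ((\<lambda>(s, v). P * s + v) ` ({c..c + t} \<times> {..<a}))"
      proof (rule ones_le_card)
        fix l assume l: "i \<le> l" "l < j" "?z l = 1"
        have "c \<le> l div P" "l div P \<le> c + t"
          using l(1,2) div_le_mono[of i l P] div_le_mono[of l "j - 1" P] t by (auto simp: c_def)
        moreover have "l mod P < a"
          using l(3) by (auto simp: periodize_def split: if_splits)
        ultimately show "l \<in> (\<lambda>(s, v). P * s + v) ` ({c..c + t} \<times> {..<a})"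
          by (intro image_eqI[of _ _ "(l div P, l mod P)"]) auto
      qed simp
      also have "\<dots> \<le> card ({c..c + t} \<times> {..<a})"
        by (rule card_image_le) simp
      also have "\<dots> \<le> 2 * t * a" using t(1) by simp
      finally have "(1 + \<kappa>) * real (ones ?z i j) \<le> (1 + \<kappa>) * real (2 * t * a)"
        using \<open>\<kappa> \<ge> 0\<close> by (intro mult_left_mono of_nat_mono) auto
      also have "\<dots> = real t * (2 * (1 + \<kappa>) * real a)" by simp
      also have "\<dots> \<le> real t * real q" using q by (intro mult_left_mono) auto
      also have "\<dots> \<le> real (j - i)" using len by (simp flip: of_nat_mult)
      finally show ?thesis .
    qed
  qed
  moreover have "?z i \<in> {0, 1, 2}" for i
    using marker_shift_range[OF x, of "i mod P"] by (simp add: periodize_def)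
  ultimately show ?thesis by (simp add: marker_shift_def P_def image_subset_iff)
qed

section \<open>Dynamics of the marker subshift\<close>

locale marker_system =
  fixes \<kappa> :: real
  assumes \<kappa>_pos: "\<kappa> > 0"

sublocale marker_system \<subseteq> dynamical_system "marker_shift \<kappa>" prefix_dist left_shift
  by (rule dynamical_system_marker_shift)

context marker_system
begin

lemma dist_shifted_less_1_iff:
  "prefix_dist ((left_shift ^^ m) x) ((left_shift ^^ n) y) < 1 \<longleftrightarrow> x m = y n"
  by (simp add: prefix_dist_less_1_iff funpow_left_shift)

text \<open>The orbit glued from \<open>x\<close> and \<open>y\<close> starts with \<open>k \<epsilon>\<close> symbols of \<open>x\<close>, which is closeness \<open>\<epsilon>\<close> at
  one time, and contains \<open>n + k \<epsilon>\<close> symbols of \<open>y\<close>, which is closeness \<open>\<epsilon>\<close> at \<open>n\<close> times. The summand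
  that depends on \<open>k \<epsilon>\<close> is constant in \<open>n\<close> and does not change the growth rate \<open>\<kappa>\<close>.\<close>

lemma m_transitive_linear_gap:
  assumes k: "\<And>\<epsilon> x y. \<epsilon> > 0 \<Longrightarrow> \<forall>i<k \<epsilon>. x i = y i \<Longrightarrow> prefix_dist x (y :: nat \<Rightarrow> nat) < \<epsilon>"
  shows "m_transitive (\<lambda>\<epsilon> x y n. nat \<lceil>\<kappa> * real n\<rceil> + (nat \<lceil>(1 + 2 * \<kappa>) * real (k \<epsilon>)\<rceil> + k \<epsilon>))"
proof (rule shadowing_imp_m_transitive)
  fix \<epsilon> :: real and x y
  assume "\<epsilon> > 0" and x: "x \<in> marker_shift \<kappa>" and y: "y \<in> marker_shift \<kappa>"
  let ?k = "k \<epsilon>"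
  have "\<exists>z\<in>marker_shift \<kappa>. \<exists>p\<le>nat \<lceil>\<kappa> * real n\<rceil> + (nat \<lceil>(1 + 2 * \<kappa>) * real ?k\<rceil> + ?k).
      prefix_dist z x < \<epsilon> \<and>
      (\<forall>j<n. prefix_dist ((left_shift ^^ (p + j)) z) ((left_shift ^^ j) y) < \<epsilon>)" for n
  proof -
    define q where "q = nat \<lceil>\<kappa> * real n\<rceil> + nat \<lceil>(1 + 2 * \<kappa>) * real ?k\<rceil>"
    define z where "z = glue x ?k q y (n + ?k)"
    have "(1 + \<kappa>) * real ?k + \<kappa> * real (n + ?k) = \<kappa> * real n + (1 + 2 * \<kappa>) * real ?k"
      by (simp add: algebra_simps)
    also have "\<dots> \<le> real q"
      unfolding q_def of_nat_add by (intro add_mono real_nat_ceiling_ge)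
    finally have "z \<in> marker_shift \<kappa>"
      unfolding z_def using x y \<kappa>_pos by (intro glue_in_marker_shift) auto
    moreover have "prefix_dist z x < \<epsilon>"
      by (rule k[OF \<open>\<epsilon> > 0\<close>]) (simp add: z_def glue_def)
    moreover have "prefix_dist ((left_shift ^^ (?k + q + j)) z) ((left_shift ^^ j) y) < \<epsilon>" if "j < n" for j
      using that by (intro k[OF \<open>\<epsilon> > 0\<close>]) (auto simp: z_def glue_def funpow_left_shift)
    ultimately show ?thesis
      by (intro bexI[of _ z] exI[of _ "?k + q"]) (auto simp: q_def)
  qed
  then show "\<exists>N\<ge>1. \<forall>n\<ge>N. \<exists>z\<in>marker_shift \<kappa>.
      \<exists>p\<le>nat \<lceil>\<kappa> * real n\<rceil> + (nat \<lceil>(1 + 2 * \<kappa>) * real ?k\<rceil> + ?k). prefix_dist z x < \<epsilon> \<and>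
      (\<forall>j<n. prefix_dist ((left_shift ^^ (p + j)) z) ((left_shift ^^ j) y) < \<epsilon>)"
    by blast
qed

text \<open>At distance less than 1 the orbit has the symbol 2 at time 0 and the symbol 1 during the \<open>n\<close>
  times after the gap \<open>p\<close>, so the cap on ones reads \<open>(1 + \<kappa>) n \<le> p + n\<close>.\<close>

lemma m_transitive_gap_lower_bound:
  assumes "m_transitive m"
  obtains N where "\<And>n. n \<ge> N \<Longrightarrow> \<kappa> * real n \<le> real (m 1 (\<lambda>_. 2) (\<lambda>_. 1) n)"
proof -
  have "(\<lambda>_. 2) \<in> marker_shift \<kappa>" "(\<lambda>_. 1) \<in> marker_shift \<kappa>"
    by (simp_all add: const_in_marker_shift)
  then obtain N where N: "\<forall>n\<ge>N. \<exists>z\<in>marker_shift \<kappa>. \<exists>p\<le>m 1 (\<lambda>_. 2) (\<lambda>_. 1) n.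
      prefix_dist z (\<lambda>_. 2) < 1 \<and>
      (\<forall>j<n. prefix_dist ((left_shift ^^ (p + j)) z) ((left_shift ^^ j) (\<lambda>_. 1)) < 1)"
    using assms zero_less_one unfolding m_transitive_def by blast
  have "\<kappa> * real n \<le> real (m 1 (\<lambda>_. 2) (\<lambda>_. 1) n)" if n: "n \<ge> N" for n
  proof -
    obtain z p where z: "z \<in> marker_shift \<kappa>" and p: "p \<le> m 1 (\<lambda>_. 2) (\<lambda>_. 1) n"
      and "z 0 = 2" and one: "\<forall>j<n. z (p + j) = 1"
      using N n by (auto simp: prefix_dist_less_1_iff funpow_left_shift)
    have "card {p..<p + n} \<le> ones z 0 (p + n)"
    proof (rule card_le_ones)
      show "z l = 1" if "l \<in> {p..<p + n}" for l
        using that one[rule_format, of "l - p"] by auto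
    qed auto
    then have "(1 + \<kappa>) * real n \<le> (1 + \<kappa>) * real (ones z 0 (p + n))"
      using \<kappa>_pos by (intro mult_left_mono) auto
    also have "\<dots> \<le> real (p + n)"
      using marker_shiftD[OF z \<open>z 0 = 2\<close>, of "p + n"] by simp
    finally show ?thesis using p by (simp add: algebra_simps)
  qed
  with that show thesis by blast
qed

lemma dense_periodic_points: "mtopology closure_of periodic_points = marker_shift \<kappa>"
proof -
  have "\<exists>y\<in>periodic_points. y \<in> mball x r" if x: "x \<in> marker_shift \<kappa>" and "r > 0" for x r
  proof -
    obtain k where k: "\<And>x y :: nat \<Rightarrow> nat. (\<forall>i<k. x i = y i) \<Longrightarrow> prefix_dist x y < r"
      using agreement_imp_prefix_dist_less[OF \<open>r > 0\<close>] by metis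
    define q where "q = Suc (nat \<lceil>2 * (1 + \<kappa>) * real k\<rceil>)"
    define y where "y = periodize x k (k + q)"
    have "2 * (1 + \<kappa>) * real k \<le> real q"
      using real_nat_ceiling_ge[of "2 * (1 + \<kappa>) * real k"] by (simp add: q_def)
    then have y: "y \<in> marker_shift \<kappa>"
      unfolding y_def using x \<kappa>_pos by (intro periodize_in_marker_shift) (auto simp: q_def)
    have "(left_shift ^^ (k + q)) y = y"
      by (rule ext) (simp add: y_def periodize_def funpow_left_shift)
    then have "y \<in> periodic_points"
      unfolding periodic_points_def using y by (auto intro!: exI[of _ "k + q"] simp: q_def)
    moreover have "prefix_dist x y < r"
      by (rule k) (simp add: y_def periodize_def q_def)
    ultimately show ?thesis using x y by auto
  qed
  then show ?thesis
    unfolding metric_closure_of by blast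
qed

text \<open>The \<open>2\<^sup>n\<close> binary words of length \<open>n\<close>, continued by zeros, differ at some time before \<open>n\<close> and
  are then at distance 1.\<close>

lemma topological_entropy_pos: "topological_entropy > 0"
proof -
  define E :: "nat \<Rightarrow> (nat \<Rightarrow> nat) set" where "E n = (\<lambda>A i. if i \<in> A then 1 else 0) ` Pow {..<n}" for n
  have inj: "inj_on (\<lambda>A i. if i \<in> A then 1 else 0 :: nat) S" for S
    by (auto simp: inj_on_def fun_eq_iff split: if_splits)
  have card_E: "card (E n) = 2 ^ n" for n
    by (simp add: E_def card_image[OF inj] card_Pow)
  have "E n \<subseteq> marker_shift \<kappa>" for n
    by (auto simp: E_def intro!: binary_in_marker_shift split: if_splits)
  moreover have "finite (E n)" for n
    by (simp add: E_def)
  moreover have "separated n (1/2) (E n)" for n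
    unfolding separated_def
  proof (intro ballI impI)
    fix x y assume xy: "x \<in> E n" "y \<in> E n" "x \<noteq> y"
    then obtain A B where AB: "A \<subseteq> {..<n}" "x = (\<lambda>i. if i \<in> A then 1 else 0)"
        "B \<subseteq> {..<n}" "y = (\<lambda>i. if i \<in> B then 1 else 0)"
      by (auto simp: E_def)
    then have "A \<noteq> B" using xy by blast
    then obtain j where "j \<in> A \<longleftrightarrow> j \<notin> B" by blast
    then have "j < n" "x j \<noteq> y j"
      using AB by (auto split: if_splits)
    then have "\<not> prefix_dist ((left_shift ^^ j) x) ((left_shift ^^ j) y) < 1"
      by (simp add: dist_shifted_less_1_iff)
    with \<open>j < n\<close> show "\<exists>j<n. 1/2 < prefix_dist ((left_shift ^^ j) x) ((left_shift ^^ j) y)"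
      by (intro exI[of _ j]) simp
  qed
  ultimately have sup: "ereal (ln (real (card (E n))) / real n)
      \<le> (SUP E\<in>{E. E \<subseteq> marker_shift \<kappa> \<and> finite E \<and> separated n (1/2) E}. ereal (ln (real (card E)) / real n))" for n
    by (intro SUP_upper) auto
  have "ereal (ln 2) \<le> separated_growth (1/2)"
    unfolding separated_growth_def
  proof (intro le_Limsup eventually_sequentiallyI[of 1])
    fix n :: nat assume "n \<ge> 1"
    then have "ln (real (card (E n))) / real n = ln 2"
      by (simp add: card_E ln_realpow)
    with sup[of n] show "ereal (ln 2)
        \<le> (SUP E\<in>{E. E \<subseteq> marker_shift \<kappa> \<and> finite E \<and> separated n (1/2) E}. ereal (ln (real (card E)) / real n))"
      by metis
  qed simp
  also have "\<dots> \<le> topological_entropy"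
    unfolding topological_entropy_eq_SUP by (rule SUP_upper) simp
  finally show ?thesis
    by (rule less_le_trans[rotated]) simp
qed

text \<open>With error rate \<open>\<delta>\<close> and gap rate \<open>\<kappa> / 4\<close>, after \<open>M\<close> blocks that follow \<open>1\<^sup>\<infinity>\<close> there are at least
  \<open>M (1 - \<delta>) n\<close> ones in a window of length at most \<open>(M + 1) n (1 + \<kappa> / 4)\<close> that starts at a marker.\<close>

lemma not_approximate_product_property: "\<not> approximate_product_property"
proof
  assume app: "approximate_product_property"
  \<comment> \<open>This \<open>\<delta>\<close> turns the lower bound on \<open>1 + \<kappa>\<close> times the number of ones into \<open>M n (1 + \<kappa> / 2)\<close>,
    and \<open>1 + \<kappa> / 2\<close> exceeds the length factor \<open>1 + \<kappa> / 4\<close>.\<close>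
  define \<delta> where "\<delta> = \<kappa> / (2 * (1 + \<kappa>))"
  have \<delta>: "\<delta> > 0" "\<delta> < 1" "(1 + \<kappa>) * (1 - \<delta>) = 1 + \<kappa> / 2"
    using \<kappa>_pos by (simp_all add: \<delta>_def field_simps)
  have "\<kappa> / 4 > 0" using \<kappa>_pos by simp
  define xs :: "nat \<Rightarrow> nat \<Rightarrow> nat" where "xs i = (\<lambda>_. if i = 1 then 2 else 1)" for i
  have xs: "\<forall>i\<ge>1. xs i \<in> marker_shift \<kappa>"
    by (simp add: xs_def const_in_marker_shift)
  define shadowed where "shadowed n xs \<longleftrightarrow> (\<exists>h :: nat \<Rightarrow> nat. \<exists>x\<in>marker_shift \<kappa>. h 1 = 0 \<and>
      (\<forall>i\<ge>1. real n \<le> real (h (i + 1)) - real (h i) \<and>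
        real (h (i + 1)) - real (h i) \<le> real n * (1 + \<kappa> / 4) \<and>
        real (card {j. j < n \<and> prefix_dist ((left_shift ^^ (h i + j)) x) ((left_shift ^^ j) (xs i)) \<ge> 1})
          \<le> \<delta> * real n))" for n xs
  have "\<exists>N\<ge>1. \<forall>n\<ge>N. \<forall>xs. (\<forall>i\<ge>1. xs i \<in> marker_shift \<kappa>) \<longrightarrow> shadowed n xs"
    unfolding shadowed_def
    by (rule app[unfolded approximate_product_property_def, rule_format, OF zero_less_one \<delta>(1) \<open>\<kappa> / 4 > 0\<close>])
  then obtain n where n: "n \<ge> 1" and "shadowed n xs"
    using xs by blast
  then obtain h x where x: "x \<in> marker_shift \<kappa>" and "h 1 = 0"
    and h_ge: "\<And>i. i \<ge> 1 \<Longrightarrow> real n \<le> real (h (i + 1)) - real (h i)"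
    and h_le: "\<And>i. i \<ge> 1 \<Longrightarrow> real (h (i + 1)) - real (h i) \<le> real n * (1 + \<kappa> / 4)"
    and close: "\<And>i. i \<ge> 1 \<Longrightarrow> real (card {j. j < n \<and>
        prefix_dist ((left_shift ^^ (h i + j)) x) ((left_shift ^^ j) (xs i)) \<ge> 1}) \<le> \<delta> * real n"
    unfolding shadowed_def by blast
  define good where "good i = {j. j < n \<and> x (h i + j) = xs i j}" for i
  have good: "(1 - \<delta>) * real n \<le> real (card (good i))" if "i \<ge> 1" for i
  proof -
    have "{j. j < n \<and> prefix_dist ((left_shift ^^ (h i + j)) x) ((left_shift ^^ j) (xs i)) \<ge> 1}
        = {..<n} - good i"
      by (auto simp: good_def dist_shifted_less_1_iff not_less[symmetric] simp del: not_less)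
    then have "real (card ({..<n} - good i)) \<le> \<delta> * real n"
      using close[OF that] by simp
    moreover have sub: "good i \<subseteq> {..<n}" by (auto simp: good_def)
    moreover have "card (good i) \<le> n"
      using card_mono[OF _ sub] by simp
    ultimately show ?thesis
      by (simp add: card_Diff_subset finite_subset[OF sub] of_nat_diff algebra_simps)
  qed
  have "(1 - \<delta>) * real n > 0" using \<delta> n by simp
  then have "good 1 \<noteq> {}" using good[of 1] by auto
  then obtain i0 where i0: "i0 < n" "x i0 = 2"
    using \<open>h 1 = 0\<close> by (auto simp: good_def xs_def)
  \<comment> \<open>Block 1 follows \<open>2\<^sup>\<infinity>\<close> and contains the marker \<open>i0\<close>, so the ones are counted from block 2 on,
    which starts at \<open>h 2 \<ge> n > i0\<close>; the \<open>M\<close> blocks end before \<open>h (M + 2)\<close>.\<close>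
  have bound: "real (h (M + 1)) \<le> real M * (real n * (1 + \<kappa> / 4))
      \<and> n \<le> h (M + 2) \<and> real M * ((1 - \<delta>) * real n) \<le> real (ones x i0 (h (M + 2)))" for M
  proof (induction M)
    case 0
    show ?case using \<open>h 1 = 0\<close> h_ge[of 1] by (simp add: numeral_2_eq_2)
  next
    case (Suc M)
    have step: "h (M + 2) + n \<le> h (M + 3)"
      using h_ge[of "M + 2"] by (simp add: numeral_3_eq_3 numeral_2_eq_2)
    have "card ((+) (h (M + 2)) ` good (M + 2) \<union> {l \<in> {i0..<h (M + 2)}. x l = 1}) \<le> ones x i0 (h (M + 3))"
      using step Suc i0 by (intro card_le_ones) (auto simp: good_def xs_def)
    also have "card ((+) (h (M + 2)) ` good (M + 2) \<union> {l \<in> {i0..<h (M + 2)}. x l = 1})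
        = card (good (M + 2)) + ones x i0 (h (M + 2))"
      unfolding ones_def by (subst card_Un_disjoint) (auto simp: card_image good_def)
    finally have "real (card (good (M + 2))) + real (ones x i0 (h (M + 2))) \<le> real (ones x i0 (h (M + 3)))"
      by linarith
    moreover have "h (Suc M + 2) = h (M + 3)" by (simp add: numeral_3_eq_3 numeral_2_eq_2)
    moreover have "real (h (Suc M + 1)) \<le> real (Suc M) * (real n * (1 + \<kappa> / 4))"
    proof -
      have "real (h (Suc M + 1)) \<le> real (h (M + 1)) + real n * (1 + \<kappa> / 4)"
        using h_le[of "M + 1"] by simp
      with conjunct1[OF Suc] show ?thesis
        unfolding of_nat_Suc distrib_right mult_1_left by linarith
    qed
    ultimately show ?case
      using Suc good[of "M + 2"] step by (auto simp: algebra_simps)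
  qed
  have "real M * (\<kappa> / 4) \<le> 1 + \<kappa> / 4" for M
  proof -
    have "real M * (1 + \<kappa> / 2) * real n = (1 + \<kappa>) * (real M * ((1 - \<delta>) * real n))"
      by (simp flip: \<delta>(3))
    also have "\<dots> \<le> (1 + \<kappa>) * real (ones x i0 (h (M + 2)))"
      using bound[of M] \<kappa>_pos by (intro mult_left_mono) auto
    also have "\<dots> \<le> real (h (M + 2) - i0)"
      by (rule marker_shiftD[OF x i0(2)])
    also have "\<dots> \<le> real (h (Suc M + 1))" by simp
    also have "\<dots> \<le> real (Suc M) * (1 + \<kappa> / 4) * real n"
      using bound[of "Suc M"] by (simp add: mult_ac)
    finally have "real M * (1 + \<kappa> / 2) \<le> real (Suc M) * (1 + \<kappa> / 4)"
      using n by simp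
    then show ?thesis by (simp add: field_simps)
  qed
  then show False
    using reals_Archimedean3[OF \<open>\<kappa> / 4 > 0\<close>] by (meson not_less)
qed

end

theorem theorem5:
  fixes \<kappa> :: real
  assumes "\<kappa> > 0"
  shows "\<exists>(X :: (nat \<Rightarrow> nat) set) d T m.
    dynamical_system X d T \<and>
    dynamical_system.m_transitive X d T m \<and>
    (\<forall>\<epsilon>>0. \<forall>x\<in>X. \<forall>y\<in>X. (\<lambda>n. real (m \<epsilon> x y n) / real n) \<longlonglongrightarrow> \<kappa>) \<and>
    (\<forall>\<kappa>' m'. 0 < \<kappa>' \<and> \<kappa>' < \<kappa> \<and>
       (\<forall>\<epsilon>>0. \<forall>x\<in>X. \<forall>y\<in>X. (\<lambda>n. real (m' \<epsilon> x y n) / real n) \<longlonglongrightarrow> \<kappa>') \<longrightarrow>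
       \<not> dynamical_system.m_transitive X d T m') \<and>
    Metric_space.mtopology X d closure_of (dynamical_system.periodic_points X T) = X \<and>
    dynamical_system.measure_center X d T = X \<and>
    dynamical_system.topological_entropy X d T > 0 \<and>
    \<not> dynamical_system.approximate_product_property X d T \<and>
    \<not> dynamical_system.minimal X d T \<and>
    \<not> dynamical_system.uniquely_ergodic X d T"
proof -
  interpret marker_system \<kappa> by unfold_locales (rule assms)
  have "\<forall>\<epsilon>. \<exists>k. \<epsilon> > 0 \<longrightarrow> (\<forall>x y :: nat \<Rightarrow> nat. (\<forall>i<k. x i = y i) \<longrightarrow> prefix_dist x y < \<epsilon>)"
    by (metis agreement_imp_prefix_dist_less)
  then obtain k where k: "\<And>\<epsilon> x y. \<epsilon> > 0 \<Longrightarrow> \<forall>i<k \<epsilon>. x i = y i \<Longrightarrow> prefix_dist x (y :: nat \<Rightarrow> nat) < \<epsilon>"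
    by metis
  define C where "C \<epsilon> = nat \<lceil>(1 + 2 * \<kappa>) * real (k \<epsilon>)\<rceil> + k \<epsilon>" for \<epsilon>
  define m where "m = (\<lambda>\<epsilon> (x :: nat \<Rightarrow> nat) (y :: nat \<Rightarrow> nat) n. nat \<lceil>\<kappa> * real n\<rceil> + C \<epsilon>)"
  have "m_transitive m"
    unfolding m_def C_def using k by (rule m_transitive_linear_gap)
  moreover have "(\<lambda>n. real (m \<epsilon> x y n) / real n) \<longlonglongrightarrow> \<kappa>" for \<epsilon> x y
  proof (rule tendsto_sandwich)
    show "\<forall>\<^sub>F n in sequentially. \<kappa> \<le> real (m \<epsilon> x y n) / real n"
    proof (rule eventually_sequentiallyI[of 1])
      fix n :: nat assume "n \<ge> 1"
      then show "\<kappa> \<le> real (m \<epsilon> x y n) / real n"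
        using real_nat_ceiling_ge[of "\<kappa> * real n"] by (simp add: m_def field_simps)
    qed
    show "\<forall>\<^sub>F n in sequentially. real (m \<epsilon> x y n) / real n \<le> \<kappa> + (1 + real (C \<epsilon>)) / real n"
    proof (rule eventually_sequentiallyI[of 1])
      fix n :: nat assume "n \<ge> 1"
      have "real (nat \<lceil>\<kappa> * real n\<rceil>) \<le> \<kappa> * real n + 1"
        using assms by (simp add: of_nat_nat of_int_ceiling_le_add_one)
      then have "real (m \<epsilon> x y n) / real n \<le> (\<kappa> * real n + (1 + real (C \<epsilon>))) / real n"
        by (intro divide_right_mono) (simp_all add: m_def)
      also have "\<dots> = \<kappa> + (1 + real (C \<epsilon>)) / real n"
        using \<open>n \<ge> 1\<close> by (simp add: add_divide_distrib)
      finally show "real (m \<epsilon> x y n) / real n \<le> \<kappa> + (1 + real (C \<epsilon>)) / real n" .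
    qed
    show "(\<lambda>n. \<kappa> + (1 + real (C \<epsilon>)) / real n) \<longlonglongrightarrow> \<kappa>"
      using tendsto_add[OF tendsto_const lim_const_over_n[of "1 + real (C \<epsilon>)"], of \<kappa>] by simp
  qed simp
  moreover have "\<not> m_transitive m'"
    if "\<kappa>' < \<kappa>" and lim: "\<forall>\<epsilon>>0. \<forall>x\<in>marker_shift \<kappa>. \<forall>y\<in>marker_shift \<kappa>.
       (\<lambda>n. real (m' \<epsilon> x y n) / real n) \<longlonglongrightarrow> \<kappa>'" for \<kappa>' m'
  proof
    assume "m_transitive m'"
    then obtain N where N: "\<And>n. n \<ge> N \<Longrightarrow> \<kappa> * real n \<le> real (m' 1 (\<lambda>_. 2) (\<lambda>_. 1) n)"
      using m_transitive_gap_lower_bound by metis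
    have "(\<lambda>n. real (m' 1 (\<lambda>_. 2) (\<lambda>_. 1) n) / real n) \<longlonglongrightarrow> \<kappa>'"
      using lim by (simp add: const_in_marker_shift)
    moreover have "\<kappa> \<le> real (m' 1 (\<lambda>_. 2) (\<lambda>_. 1) n) / real n" if "n \<ge> max N 1" for n
      using N[of n] that by (simp add: field_simps)
    ultimately have "\<kappa> \<le> \<kappa>'"
      by (intro LIMSEQ_le_const) blast+
    with \<open>\<kappa>' < \<kappa>\<close> show False by simp
  qed
  moreover have "\<not> minimal" "\<not> uniquely_ergodic"
    by (rule two_fixed_points[of "\<lambda>_. 0" "\<lambda>_. 1"];
        simp add: const_in_marker_shift fun_eq_iff)+
  ultimately show ?thesis
    using dynamical_system_axioms dense_periodic_points topological_entropy_pos
      dense_periodic_points_imp_measure_center[OF dense_periodic_points]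
      not_approximate_product_property
    by (intro exI[of _ "marker_shift \<kappa>"] exI[of _ prefix_dist] exI[of _ left_shift] exI[of _ m]) blast
qed

end
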